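(* Let $X$ be a Tychonoff space and let $I$ be an ideal in $C(X)$. Then the following four statements are equivalent: (1) $X$ is $I$-pseudocompact. (2) $C^*_I(X)=C(X)$. (3) $C_{\psi^I}(X)=C^*_I(X)$. (4) $C^*_I(X)$ is an ideal in $C(X)$.
   Context: $C(X)$ is the ring of all real-valued continuous functions on $X$; ideals may be improper. $Z(g)=\{x\in X:g(x)=0\}$ and $\bigcap Z[I]=\bigcap_{g\in I}Z(g)$. A subset $Y\subseteq X$ is bounded if every $f\in C(X)$ is bounded on $Y$. $X$ is $I$-pseudocompact if $X\setminus\bigcap Z[I]$ is a bounded subset of $X$. Define $$C_{\psi^I}(X)=\{f\in C(X): \overline{(X\setminus Z(f))\cap (X\setminus\textstyle\bigcap Z[I])}\text{ is a bounded subset of }X\}$$ (closure in $X$) and $$C_I^*(X)=\{f\in C(X): f\text{ is bounded on }X\setminus\textstyle\bigcap Z[I]\}.$$ *)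

theory Defs
  imports "HOL-Analysis.Analysis" "HOL-Algebra.Ideal"
begin

definition tychonoff_space :: "'a topology \<Rightarrow> bool" where
  "tychonoff_space X \<longleftrightarrow> completely_regular_space X \<and> Hausdorff_space X"

text \<open>The ring \<open>C(X)\<close> with pointwise operations. A function on the space is represented by
  its extensional representative (with value \<open>undefined\<close> outside the carrier \<open>topspace X\<close>),
  so that equality of ring elements is equality of functions on the space.\<close>

definition continuous_function_ring :: "'a topology \<Rightarrow> ('a \<Rightarrow> real) ring" where
  "continuous_function_ring X =
     \<lparr>carrier = {f \<in> extensional (topspace X). continuous_map X euclideanreal f},
      mult = (\<lambda>f g. \<lambda>x\<in>topspace X. f x * g x),
      one = (\<lambda>x\<in>topspace X. 1),
      zero = (\<lambda>x\<in>topspace X. 0),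
      add = (\<lambda>f g. \<lambda>x\<in>topspace X. f x + g x)\<rparr>"

lemma cring_continuous_function_ring: "cring (continuous_function_ring X)"
proof (rule cringI)
  have restr: "continuous_map X euclideanreal (\<lambda>x. if x \<in> topspace X then f x else undefined)
      \<longleftrightarrow> continuous_map X euclideanreal f" for f
    by (auto elim: continuous_map_eq)
  note [simp] = continuous_function_ring_def restrict_def fun_eq_iff extensional_def
    restr algebra_simps
  show "abelian_group (continuous_function_ring X)"
  proof (rule abelian_groupI, goal_cases)
    case (6 f)
    then show ?case
      by (intro bexI[of _ "\<lambda>x\<in>topspace X. - f x"]) (auto intro: continuous_map_minus)
  qed (auto intro: continuous_map_add)
  show "comm_monoid (continuous_function_ring X)"
    by (rule comm_monoidI) (auto intro: continuous_map_real_mult)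
qed (auto simp: continuous_function_ring_def restrict_def fun_eq_iff algebra_simps)

definition zero_set :: "'a topology \<Rightarrow> ('a \<Rightarrow> real) \<Rightarrow> 'a set" where
  "zero_set X g = {x \<in> topspace X. g x = 0}"

definition bounded_subset :: "'a topology \<Rightarrow> 'a set \<Rightarrow> bool" where
  "bounded_subset X Y \<longleftrightarrow>
     Y \<subseteq> topspace X \<and> (\<forall>f \<in> carrier (continuous_function_ring X). bounded (f ` Y))"

definition ideal_pseudocompact :: "'a topology \<Rightarrow> ('a \<Rightarrow> real) set \<Rightarrow> bool" where
  "ideal_pseudocompact X I \<longleftrightarrow> bounded_subset X (topspace X - (\<Inter>g\<in>I. zero_set X g))"

definition C_psi :: "'a topology \<Rightarrow> ('a \<Rightarrow> real) set \<Rightarrow> ('a \<Rightarrow> real) set" where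
  "C_psi X I =
     {f \<in> carrier (continuous_function_ring X).
        bounded_subset X (X closure_of
          ((topspace X - zero_set X f) \<inter> (topspace X - (\<Inter>g\<in>I. zero_set X g))))}"

definition C_star :: "'a topology \<Rightarrow> ('a \<Rightarrow> real) set \<Rightarrow> ('a \<Rightarrow> real) set" where
  "C_star X I =
     {f \<in> carrier (continuous_function_ring X).
        bounded (f ` (topspace X - (\<Inter>g\<in>I. zero_set X g)))}"

end

theory Submission
  imports Defs
begin

text \<open>Everything is tested on the constant function 1. Write A for the complement of the
  common zero set of \<open>I\<close>. Unfolding definitions, A is bounded iff every continuous
  function is bounded on A, which is (1) iff (2) (\<open>C_star_eq_carrier_iff\<close>). The
  function 1 always lies in \<open>C_star X I\<close>, so that set is an ideal only if it is the
  whole ring. Since 1 vanishes nowhere, it lies in \<open>C_psi X I\<close> exactly when A is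
  bounded (\<open>one_in_C_psi_iff\<close>), so (3) forces (1); conversely, if A is bounded, both
  sets in (3) are the whole ring.\<close>

lemma bounded_subset_mono:
  assumes "bounded_subset X T" and "S \<subseteq> T"
  shows "bounded_subset X S"
  using assms unfolding bounded_subset_def by (meson bounded_subset image_mono subset_trans)

lemma bounded_subset_closure_of:
  assumes "bounded_subset X S"
  shows "bounded_subset X (X closure_of S)"
  unfolding bounded_subset_def
proof (intro conjI ballI)
  fix f assume f: "f \<in> carrier (continuous_function_ring X)"
  then have "continuous_map X euclideanreal f"
    by (simp add: continuous_function_ring_def)
  then have "f ` (X closure_of S) \<subseteq> closure (f ` S)"
    using continuous_map_image_closure_subset by force
  moreover have "bounded (closure (f ` S))"
    using assms f by (auto simp: bounded_subset_def)
  ultimately show "bounded (f ` (X closure_of S))"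
    by (rule bounded_subset[rotated])
qed (rule closure_of_subset_topspace)

lemma C_star_eq_carrier_iff:
  "C_star X I = carrier (continuous_function_ring X) \<longleftrightarrow> ideal_pseudocompact X I"
  by (auto simp: C_star_def ideal_pseudocompact_def bounded_subset_def)

lemma one_in_C_star: "\<one>\<^bsub>continuous_function_ring X\<^esub> \<in> C_star X I"
proof -
  interpret cring "continuous_function_ring X"
    by (rule cring_continuous_function_ring)
  \<comment> \<open>Only an inclusion: the set may be empty, for instance when \<open>I\<close> is
    the zero ideal.\<close>
  have "\<one>\<^bsub>continuous_function_ring X\<^esub> ` (topspace X - (\<Inter>g\<in>I. zero_set X g)) \<subseteq> {1}"
    by (auto simp: continuous_function_ring_def)
  then have "bounded (\<one>\<^bsub>continuous_function_ring X\<^esub> ` (topspace X - (\<Inter>g\<in>I. zero_set X g)))"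
    by (meson bounded_subset finite_imp_bounded finite.intros)
  then show ?thesis
    by (simp add: C_star_def)
qed

lemma one_in_C_psi_iff:
  "\<one>\<^bsub>continuous_function_ring X\<^esub> \<in> C_psi X I \<longleftrightarrow> ideal_pseudocompact X I"
proof -
  interpret cring "continuous_function_ring X"
    by (rule cring_continuous_function_ring)
  let ?A = "topspace X - (\<Inter>g\<in>I. zero_set X g)"
  have "zero_set X \<one>\<^bsub>continuous_function_ring X\<^esub> = {}"
    by (auto simp: zero_set_def continuous_function_ring_def)
  then have "\<one>\<^bsub>continuous_function_ring X\<^esub> \<in> C_psi X I \<longleftrightarrow> bounded_subset X (X closure_of ?A)"
    by (simp add: C_psi_def Int_absorb1)
  moreover have "?A \<subseteq> X closure_of ?A"
    by (simp add: closure_of_subset)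
  ultimately show ?thesis
    unfolding ideal_pseudocompact_def
    using bounded_subset_mono bounded_subset_closure_of by blast
qed

text \<open>Whatever \<open>f\<close> is, the set whose closure is tested lies inside the bounded
  set \<open>topspace X - (\<Inter>g\<in>I. zero_set X g)\<close>.\<close>

lemma C_psi_eq_carrier:
  assumes "ideal_pseudocompact X I"
  shows "C_psi X I = carrier (continuous_function_ring X)"
  using assms unfolding C_psi_def ideal_pseudocompact_def
  by (auto intro: bounded_subset_closure_of bounded_subset_mono)

theorem theorem3p8:
  fixes X :: "'a topology" and I :: "('a \<Rightarrow> real) set"
  assumes "tychonoff_space X"
    and "ideal I (continuous_function_ring X)"
  shows "(ideal_pseudocompact X I \<longleftrightarrow> C_star X I = carrier (continuous_function_ring X)) \<and>
         (C_star X I = carrier (continuous_function_ring X) \<longleftrightarrow> C_psi X I = C_star X I) \<and>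
         (C_psi X I = C_star X I \<longleftrightarrow> ideal (C_star X I) (continuous_function_ring X))"
proof -
  interpret cring "continuous_function_ring X"
    by (rule cring_continuous_function_ring)
  have "C_psi X I = C_star X I \<longleftrightarrow> ideal_pseudocompact X I"
    using one_in_C_star one_in_C_psi_iff C_psi_eq_carrier C_star_eq_carrier_iff by metis
  moreover have "ideal (C_star X I) (continuous_function_ring X) \<longleftrightarrow>
      C_star X I = carrier (continuous_function_ring X)"
    \<comment> \<open>An ideal containing 1 is the whole ring; conversely the whole ring counts as
      an ideal, since ideals may be improper.\<close>
    using ideal.one_imp_carrier one_in_C_star oneideal by metis
  ultimately show ?thesis
    using C_star_eq_carrier_iff by metis
qed

end
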